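(* The $\mathbb{F}$-algebra $U_q(\mathfrak{sl}_2)$ has a presentation by generators $A,y^{\pm 1}$ and relations $$yy^{-1} = y^{-1}y = 1,$$ $$y^2A-(q^2+q^{-2})yAy+Ay^2= -(a+a^{-1})(q-q^{-1})^2y,$$ $$Ay^2A+AyAy+yAyA-[3]_q\, yA^2y + (a+a^{-1})(q-q^{-1})^2(Ay+yA) = (q^2-q^{-2})^2 y^2 +(aq-a^{-1}q^{-1})(aq^{-1}-a^{-1}q)(q-q^{-1})^2.$$ An isomorphism from this presentation to the modified Chevalley presentation (generators $\nu_x,y^{\pm1},\nu_z$) sends $$A \mapsto a(1-q\nu_x)y^{-1}+ a^{-1}(1-q^{-1}\nu_z)y^{-1},\qquad y^{\pm 1} \mapsto y^{\pm 1}.$$ The inverse isomorphism sends $$\nu_x \mapsto a^{-1}\,\frac{a+a^{-1}}{q+q^{-1}} - a^{-1} \frac{qAy-q^{-1}yA}{q^2-q^{-2}},\qquad y^{\pm 1} \mapsto y^{\pm 1},\qquad \nu_z \mapsto a\,\frac{a+a^{-1}}{q+q^{-1}} - a \frac{qyA-q^{-1}Ay}{q^2-q^{-2}}.$$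
   Context: Algebras are associative with $1$. $\mathbb{F}$ is a field, $q\in\mathbb{F}$ is nonzero with $q^4\neq 1$, and $a\in\mathbb{F}$ is nonzero with $a^2\neq 1$. Notation: $[n]_q=\frac{q^n-q^{-n}}{q-q^{-1}}$, so $[3]_q=q^2+1+q^{-2}$. $U_q(\mathfrak{sl}_2)$ is the $\mathbb{F}$-algebra with generators $x,y^{\pm1},z$ and relations $yy^{-1}=y^{-1}y=1$, $\frac{qxy-q^{-1}yx}{q-q^{-1}}=\frac{qyz-q^{-1}zy}{q-q^{-1}}=\frac{qzx-q^{-1}xz}{q-q^{-1}}=1$ (the equitable presentation). Its elements $\nu_x,\nu_z,A$ are $\nu_x=q(1-yz)=q^{-1}(1-zy)$, $\nu_z=q(1-xy)=q^{-1}(1-yx)$, $A=a^{-1}x+az$. The modified Chevalley presentation of $U_q(\mathfrak{sl}_2)$ is the presentation by generators $\nu_x,y^{\pm1},\nu_z$ and relations $yy^{-1}=y^{-1}y=1$, $y\nu_xy^{-1}=q^{-2}\nu_x$, $y\nu_zy^{-1}=q^2\nu_z$, $\frac{q\nu_z\nu_x-q^{-1}\nu_x\nu_z}{q-q^{-1}}=1-y^2$. *)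

theory Defs
  imports
    "HOL-Library.Poly_Mapping"
    "HOL-Algebra.QuotRing"
    "HOL-Algebra.Module"
    "HOL-Algebra.Algebraic_Closure_Type"
begin

section \<open>Free associative algebras\<close>

text \<open>The free monoid, written additively so that \<^typ>\<open>'w \<Rightarrow>\<^sub>0 'f\<close> carries its convolution
  product. A copy of lists is used because \<open>list\<close> itself has other additive instances in the
  libraries.\<close>

datatype 'x word = Word (letters: "'x list")

instantiation word :: (type) monoid_add
begin

definition zero_word :: "'a word" where "0 = Word []"

definition plus_word :: "'a word \<Rightarrow> 'a word \<Rightarrow> 'a word"
  where "u + v = Word (letters u @ letters v)"

instance
  by standard (simp_all add: zero_word_def plus_word_def)

end

text \<open>\<open>('f, 'x) free_algebra\<close> is the monoid algebra of \<open>'a word\<close> over \<open>'f\<close>, i.e. noncommutative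
  polynomials. Its ring operations are those of the type class \<open>ring_1\<close>.\<close>

type_synonym ('f, 'x) free_algebra = "'x word \<Rightarrow>\<^sub>0 'f"

definition gen :: "'x \<Rightarrow> ('f::field, 'x) free_algebra"
  where "gen s = Poly_Mapping.single (Word [s]) 1"

definition scal :: "'f::field \<Rightarrow> ('f, 'x) free_algebra \<Rightarrow> ('f, 'x) free_algebra"
    (infixr \<open>\<bullet>\<^sub>F\<close> 75)
  where "c \<bullet>\<^sub>F p = Poly_Mapping.single 0 c * p"


section \<open>Algebras given by generators and relations\<close>

text \<open>Algebras over \<open>'f\<close> are represented by \<open>module\<close> records: a ring together with a scalar
  multiplication. (The library locale \<open>algebra\<close> is not used, as it requires commutativity.)
  A pair \<open>(l, r)\<close> in a set of relations stands for the relation \<open>l = r\<close>. In HOL-Algebra,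
  \<open>ideal\<close> and hence \<open>genideal\<close> are two-sided.\<close>

definition relation_ideal ::
    "(('f::field, 'x) free_algebra \<times> ('f, 'x) free_algebra) set \<Rightarrow> ('f, 'x) free_algebra set"
  where "relation_ideal R = genideal ring_of_type_algebra {l - r | l r. (l, r) \<in> R}"

definition presented_class ::
    "(('f::field, 'x) free_algebra \<times> ('f, 'x) free_algebra) set
      \<Rightarrow> ('f, 'x) free_algebra \<Rightarrow> ('f, 'x) free_algebra set"
  where "presented_class R p = relation_ideal R +>\<^bsub>ring_of_type_algebra\<^esub> p"

text \<open>The scalar multiplication on cosets follows the pattern of \<open>rcoset_mult\<close>; it amounts to
  \<open>c \<odot> [p] = [c p]\<close>.\<close>

definition presented_algebra ::
    "(('f::field, 'x) free_algebra \<times> ('f, 'x) free_algebra) set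
      \<Rightarrow> ('f, ('f, 'x) free_algebra set) module"
  where "presented_algebra R =
    ring.extend (FactRing ring_of_type_algebra (relation_ideal R))
      (module.fields (\<lambda>c C. \<Union>p\<in>C. presented_class R (c \<bullet>\<^sub>F p)))"

definition alg_iso :: "('f, 'u) module \<Rightarrow> ('f, 'v) module \<Rightarrow> ('u \<Rightarrow> 'v) set"
  where "alg_iso M N =
    {h \<in> ring_iso M N. \<forall>c. \<forall>u\<in>carrier M. h (c \<odot>\<^bsub>M\<^esub> u) = c \<odot>\<^bsub>N\<^esub> h u}"

text \<open>\<open>M\<close> has a presentation by the generators \<open>g s\<close> and the relations \<open>R\<close>.\<close>

definition has_presentation ::
    "('f::field, 'u) module \<Rightarrow> ('x \<Rightarrow> 'u)
      \<Rightarrow> (('f, 'x) free_algebra \<times> ('f, 'x) free_algebra) set \<Rightarrow> bool"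
  where "has_presentation M g R \<longleftrightarrow>
    (\<exists>\<phi>\<in>alg_iso (presented_algebra R) M. \<forall>s. \<phi> (presented_class R (gen s)) = g s)"


section \<open>Presentations related to the quantum group of sl2\<close>

definition q_number :: "nat \<Rightarrow> 'f::field \<Rightarrow> 'f"
  where "q_number n q = (q ^ n - inverse q ^ n) / (q - inverse q)"

text \<open>\<open>Uq_sl2\<close> is given by the equitable presentation. In each presentation \<open>y\<^sup>-\<^sup>1\<close> is a separate letter, tied to \<open>y\<close> by relations.\<close>

datatype equitable_gen = Eq_x | Eq_y | Eq_yinv | Eq_z

datatype chevalley_gen = Ch_nux | Ch_y | Ch_yinv | Ch_nuz

datatype Ay_gen = Ay_A | Ay_y | Ay_yinv

definition equitable_relations ::
    "'f::field \<Rightarrow> (('f, equitable_gen) free_algebra \<times> ('f, equitable_gen) free_algebra) set"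
  where "equitable_relations q =
    (let x = gen Eq_x; y = gen Eq_y; yi = gen Eq_yinv; z = gen Eq_z in
     {(y * yi, 1),
      (yi * y, 1),
      ((1 / (q - inverse q)) \<bullet>\<^sub>F (q \<bullet>\<^sub>F (x * y) - inverse q \<bullet>\<^sub>F (y * x)), 1),
      ((1 / (q - inverse q)) \<bullet>\<^sub>F (q \<bullet>\<^sub>F (y * z) - inverse q \<bullet>\<^sub>F (z * y)), 1),
      ((1 / (q - inverse q)) \<bullet>\<^sub>F (q \<bullet>\<^sub>F (z * x) - inverse q \<bullet>\<^sub>F (x * z)), 1)})"

definition Uq_sl2 :: "'f::field \<Rightarrow> ('f, ('f, equitable_gen) free_algebra set) module"
  where "Uq_sl2 q = presented_algebra (equitable_relations q)"

definition Uq_y :: "'f::field \<Rightarrow> ('f, equitable_gen) free_algebra set"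
  where "Uq_y q = presented_class (equitable_relations q) (gen Eq_y)"

definition Uq_yinv :: "'f::field \<Rightarrow> ('f, equitable_gen) free_algebra set"
  where "Uq_yinv q = presented_class (equitable_relations q) (gen Eq_yinv)"

definition Uq_A :: "'f::field \<Rightarrow> 'f \<Rightarrow> ('f, equitable_gen) free_algebra set"
  where "Uq_A q a =
    presented_class (equitable_relations q) (inverse a \<bullet>\<^sub>F gen Eq_x + a \<bullet>\<^sub>F gen Eq_z)"

definition chevalley_relations ::
    "'f::field \<Rightarrow> (('f, chevalley_gen) free_algebra \<times> ('f, chevalley_gen) free_algebra) set"
  where "chevalley_relations q =
    (let nux = gen Ch_nux; y = gen Ch_y; yi = gen Ch_yinv; nuz = gen Ch_nuz in
     {(y * yi, 1),
      (yi * y, 1),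
      (y * nux * yi, (inverse q ^ 2) \<bullet>\<^sub>F nux),
      (y * nuz * yi, (q ^ 2) \<bullet>\<^sub>F nuz),
      ((1 / (q - inverse q)) \<bullet>\<^sub>F (q \<bullet>\<^sub>F (nuz * nux) - inverse q \<bullet>\<^sub>F (nux * nuz)), 1 - y ^ 2)})"

definition Ay_relations ::
    "'f::field \<Rightarrow> 'f \<Rightarrow> (('f, Ay_gen) free_algebra \<times> ('f, Ay_gen) free_algebra) set"
  where "Ay_relations q a =
    (let A = gen Ay_A; y = gen Ay_y; yi = gen Ay_yinv in
     {(y * yi, 1),
      (yi * y, 1),
      (y ^ 2 * A - (q ^ 2 + inverse q ^ 2) \<bullet>\<^sub>F (y * A * y) + A * y ^ 2,
       - (((a + inverse a) * (q - inverse q) ^ 2) \<bullet>\<^sub>F y)),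
      (A * y ^ 2 * A + A * y * A * y + y * A * y * A - q_number 3 q \<bullet>\<^sub>F (y * A ^ 2 * y)
         + ((a + inverse a) * (q - inverse q) ^ 2) \<bullet>\<^sub>F (A * y + y * A),
       ((q ^ 2 - inverse q ^ 2) ^ 2) \<bullet>\<^sub>F (y ^ 2)
         + ((a * q - inverse a * inverse q) * (a * inverse q - inverse a * q)
             * (q - inverse q) ^ 2) \<bullet>\<^sub>F 1)})"

end

theory Submission
  imports Defs
begin

text \<open>An isomorphism of presented algebras is obtained from two substitutions that respect the
  relations and are mutually inverse on generators modulo the relations. This is applied to
  \<open>A, y\<close> versus \<open>\<nu>\<^sub>x, y, \<nu>\<^sub>z\<close>, and to \<open>\<nu>\<^sub>x, y, \<nu>\<^sub>z\<close> versus \<open>x, y, z\<close>. For the former, substitute the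
  expressions \<open>N\<close>, \<open>M\<close> for \<open>\<nu>\<^sub>x\<close>, \<open>\<nu>\<^sub>z\<close> in terms of \<open>A y\<close> and \<open>y A\<close>. In the free algebra,
  \<open>y N - q\<^sup>-\<^sup>2 N y\<close> (and likewise \<open>y M - q\<^sup>2 M y\<close>) is a nonzero scalar multiple of the relation that
  is linear in \<open>A\<close>, and the difference of the two sides of the Chevalley relation between \<open>\<nu>\<^sub>x\<close> and
  \<open>\<nu>\<^sub>z\<close> is a nonzero scalar multiple of the relation that is quadratic in \<open>A\<close>, so that these
  identities yield both directions.\<close>

section \<open>Substitution homomorphisms of free algebras\<close>

lemma free_algebra_induct [case_names single add]:
  fixes p :: "'w \<Rightarrow>\<^sub>0 'b::monoid_add"
  assumes "\<And>w c. P (Poly_Mapping.single w c)" and "\<And>p p'. P p \<Longrightarrow> P p' \<Longrightarrow> P (p + p')"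
  shows "P p"
proof (induction p rule: update_induct)
  case const
  \<comment> \<open>Zero is the monomial with coefficient 0 on an arbitrary word.\<close>
  show ?case using assms(1)[of undefined 0] by simp
next
  case (update p w c)
  have "Poly_Mapping.update w c p = p + Poly_Mapping.single w c"
    using update.hyps(1)
    by (intro poly_mapping_eqI)
      (auto simp: lookup_update lookup_add lookup_single when_def in_keys_iff)
  then show ?case using assms update.IH by simp
qed

text \<open>The empty word is neutral and coefficients commute. Centrality of scalars is what lets
  \<open>mult_scal_right\<close> pull them out of a right factor.\<close>

lemma single_0_central: "Poly_Mapping.single 0 c * p = p * Poly_Mapping.single (0::'x word) (c::'f::field)"
proof (induction p rule: free_algebra_induct)
  case (single k v)
  show ?case by (simp add: mult_single mult.commute)
next
  case (add p p')
  then show ?case by (simp add: distrib_left distrib_right)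
qed

section \<open>Linearity of scalar multiplication\<close>

lemma scal_add_right: "c \<bullet>\<^sub>F (p + p') = c \<bullet>\<^sub>F p + c \<bullet>\<^sub>F p'"
  by (simp add: scal_def distrib_left)

lemma scal_diff_right: "c \<bullet>\<^sub>F (p - p') = c \<bullet>\<^sub>F p - c \<bullet>\<^sub>F p'"
  by (simp add: scal_def right_diff_distrib)

lemma scal_minus_right: "c \<bullet>\<^sub>F (- p) = - (c \<bullet>\<^sub>F p)"
  by (simp add: scal_def)

lemma scal_add_left: "(c + d) \<bullet>\<^sub>F p = c \<bullet>\<^sub>F p + d \<bullet>\<^sub>F p"
  by (simp add: scal_def single_add distrib_right)

lemma scal_diff_left: "(c - d) \<bullet>\<^sub>F p = c \<bullet>\<^sub>F p - d \<bullet>\<^sub>F p"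
  by (simp add: scal_def single_diff left_diff_distrib)

lemma scal_minus_left: "(- c) \<bullet>\<^sub>F p = - (c \<bullet>\<^sub>F p)"
  by (simp add: scal_def single_uminus)

lemma scal_scal: "c \<bullet>\<^sub>F d \<bullet>\<^sub>F p = (c * d) \<bullet>\<^sub>F p"
  by (simp add: scal_def mult_single flip: mult.assoc)

lemma scal_one: "1 \<bullet>\<^sub>F p = p"
  by (simp add: scal_def)

lemma scal_zero_left: "0 \<bullet>\<^sub>F p = 0"
  by (simp add: scal_def)

lemma mult_scal_left: "(c \<bullet>\<^sub>F p) * r = c \<bullet>\<^sub>F (p * r)"
  by (simp add: scal_def mult.assoc)

lemma mult_scal_right: "p * (c \<bullet>\<^sub>F r) = c \<bullet>\<^sub>F (p * r)"
  unfolding scal_def by (metis mult.assoc single_0_central)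

text \<open>Scalars are distributed over sums, merged, and pulled in front of products. Together
  with \<open>algebra_simps\<close> this normalizes the noncommutative identities below.\<close>

lemmas scal_simps = scal_add_right scal_diff_right scal_minus_right scal_add_left scal_diff_left
  scal_minus_left scal_scal scal_one scal_zero_left mult_scal_left mult_scal_right

text \<open>The unital algebra homomorphism that the universal property of the free algebra attaches
  to \<open>f\<close>.\<close>

definition subst :: "('x \<Rightarrow> ('f::field, 'y) free_algebra) \<Rightarrow> ('f, 'x) free_algebra \<Rightarrow> ('f, 'y) free_algebra"
  where "subst f p =
    (\<Sum>w\<in>Poly_Mapping.keys p. Poly_Mapping.lookup p w \<bullet>\<^sub>F prod_list (map f (letters w)))"

lemma subst_add: "subst f (p + p') = subst f p + subst f p'"
  unfolding subst_def
  by (rule setsum_keys_plus_distrib) (simp_all add: scal_zero_left scal_add_left)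

lemma subst_single: "subst f (Poly_Mapping.single w c) = c \<bullet>\<^sub>F prod_list (map f (letters w))"
  by (cases "c = 0") (simp_all add: subst_def scal_zero_left)

lemma subst_zero: "subst f 0 = 0"
  by (simp add: subst_def)

lemma subst_minus: "subst f (- p) = - subst f p"
  using subst_add[of f "- p" p] by (simp add: subst_zero eq_neg_iff_add_eq_0)

lemma subst_diff: "subst f (p - p') = subst f p - subst f p'"
  using subst_add[of f p "- p'"] by (simp add: subst_minus)

lemma subst_one: "subst f 1 = 1"
proof -
  have "subst f (Poly_Mapping.single 0 1) = 1"
    unfolding subst_single by (simp add: scal_one zero_word_def)
  then show ?thesis by simp
qed

lemma subst_gen: "subst f (gen s) = f s"
  by (simp add: gen_def subst_single scal_one)

lemma subst_mult: "subst f (p * r) = subst f p * subst f r"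
proof (induction p rule: free_algebra_induct)
  case (single k v)
  show ?case
    by (induction r rule: free_algebra_induct)
      (simp_all add: mult_single subst_single subst_add distrib_left plus_word_def scal_simps mult.commute)
next
  case (add p p')
  then show ?case by (simp add: distrib_right subst_add)
qed

lemma subst_scal: "subst f (c \<bullet>\<^sub>F p) = c \<bullet>\<^sub>F subst f p"
  by (simp add: scal_def[of c p] subst_mult subst_single zero_word_def scal_simps)

lemma subst_power: "subst f (p ^ n) = subst f p ^ n"
  by (induction n) (simp_all add: subst_one subst_mult)

lemmas subst_simps = subst_add subst_zero subst_minus subst_diff subst_one subst_gen subst_mult
  subst_scal subst_power

section \<open>Presented algebras\<close>

lemma ring_of_free_algebra: "ring (ring_of_type_algebra :: ('f::field, 'x) free_algebra ring)"
proof -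
  have "\<exists>y. x + y = 0" "\<exists>y. y + x = 0" for x :: "('f, 'x) free_algebra"
    using add.right_inverse add.left_inverse by blast+
  thus ?thesis
    unfolding ring_of_type_algebra_def
    by unfold_locales (auto simp: algebra_simps Units_def)
qed

lemma carrier_type_algebra [simp]: "carrier ring_of_type_algebra = UNIV"
  and mult_type_algebra [simp]: "x \<otimes>\<^bsub>ring_of_type_algebra\<^esub> y = x * y"
  and add_type_algebra [simp]: "x \<oplus>\<^bsub>ring_of_type_algebra\<^esub> y = x + y"
  and one_type_algebra [simp]: "\<one>\<^bsub>ring_of_type_algebra\<^esub> = 1"
  and zero_type_algebra [simp]: "\<zero>\<^bsub>ring_of_type_algebra\<^esub> = 0"
  by (simp_all add: ring_of_type_algebra_def)

section \<open>Two-sided ideals generated by relations\<close>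

lemma ideal_relation_ideal: "ideal (relation_ideal R) ring_of_type_algebra"
  unfolding relation_ideal_def by (rule ring.genideal_ideal[OF ring_of_free_algebra]) simp

lemma relation_ideal_memI: "(l, r) \<in> R \<Longrightarrow> l - r \<in> relation_ideal R"
  unfolding relation_ideal_def
  using ring.genideal_self[OF ring_of_free_algebra, of "{l - r | l r. (l, r) \<in> R}"] by auto

lemma relation_ideal_zero: "0 \<in> relation_ideal R"
  using additive_subgroup.zero_closed[OF ideal.axioms(1)[OF ideal_relation_ideal]] by simp

lemma relation_ideal_add:
  "p \<in> relation_ideal R \<Longrightarrow> p' \<in> relation_ideal R \<Longrightarrow> p + p' \<in> relation_ideal R"
  using additive_subgroup.a_closed[OF ideal.axioms(1)[OF ideal_relation_ideal]] by fastforce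

lemma relation_ideal_mult_left: "p \<in> relation_ideal R \<Longrightarrow> r * p \<in> relation_ideal R"
  using ideal.I_l_closed[OF ideal_relation_ideal] by fastforce

lemma relation_ideal_mult_right: "p \<in> relation_ideal R \<Longrightarrow> p * r \<in> relation_ideal R"
  using ideal.I_r_closed[OF ideal_relation_ideal] by fastforce

lemma relation_ideal_scal: "p \<in> relation_ideal R \<Longrightarrow> c \<bullet>\<^sub>F p \<in> relation_ideal R"
  unfolding scal_def by (rule relation_ideal_mult_left)

lemma relation_ideal_minus: "p \<in> relation_ideal R \<Longrightarrow> - p \<in> relation_ideal R"
  using relation_ideal_mult_left[of p R "- 1"] by simp

lemma relation_ideal_diff:
  "p \<in> relation_ideal R \<Longrightarrow> p' \<in> relation_ideal R \<Longrightarrow> p - p' \<in> relation_ideal R"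
  using relation_ideal_add[of p R "- p'"] relation_ideal_minus[of p' R] by simp

lemmas relation_ideal_intros = relation_ideal_zero relation_ideal_add relation_ideal_diff
  relation_ideal_minus relation_ideal_scal relation_ideal_mult_left relation_ideal_mult_right

text \<open>The preimage of a two-sided ideal under a homomorphism is a two-sided ideal. Here it
  contains the generators of \<open>relation_ideal R\<close>, hence all of it.\<close>

lemma subst_relation_ideal:
  fixes f :: "'x \<Rightarrow> ('f::field, 'y) free_algebra"
  assumes "\<And>l r. (l, r) \<in> R \<Longrightarrow> subst f l - subst f r \<in> relation_ideal S"
    and "p \<in> relation_ideal R"
  shows "subst f p \<in> relation_ideal S"
proof -
  let ?J = "{p. subst f p \<in> relation_ideal S}"
  interpret F: ring "ring_of_type_algebra :: ('f, 'x) free_algebra ring"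
    by (rule ring_of_free_algebra)
  have "ideal ?J ring_of_type_algebra"
  proof (rule idealI[OF ring_of_free_algebra])
    have "\<ominus>\<^bsub>ring_of_type_algebra\<^esub> x = - x" for x :: "('f, 'x) free_algebra"
      by (rule F.minus_equality) auto
    then show "subgroup ?J (add_monoid ring_of_type_algebra)"
      by (intro F.add.subgroupI)
        (auto simp: a_inv_def subst_simps intro: relation_ideal_intros intro!: exI[of _ 0])
  qed (auto simp: subst_simps intro: relation_ideal_intros)
  moreover have "{l - r | l r. (l, r) \<in> R} \<subseteq> ?J"
    using assms(1) by (auto simp: subst_simps)
  ultimately show ?thesis
    using F.genideal_minimal assms(2) unfolding relation_ideal_def by blast
qed

section \<open>Cosets as elements of a presented algebra\<close>

lemma presented_class_eq: "presented_class R p = (\<lambda>i. i + p) ` relation_ideal R"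
  by (auto simp: presented_class_def a_r_coset_def')

lemma presented_class_eq_iff:
  "presented_class R p = presented_class R p' \<longleftrightarrow> p - p' \<in> relation_ideal R"
proof
  assume "presented_class R p = presented_class R p'"
  moreover have "p \<in> presented_class R p"
    unfolding presented_class_eq by (rule image_eqI[OF _ relation_ideal_zero]) simp
  ultimately show "p - p' \<in> relation_ideal R"
    by (auto simp: presented_class_eq)
next
  assume d: "p - p' \<in> relation_ideal R"
  have "x \<in> presented_class R p \<longleftrightarrow> x \<in> presented_class R p'" for x
  proof -
    have mem: "x \<in> presented_class R r \<longleftrightarrow> x - r \<in> relation_ideal R" for r
      by (auto simp: presented_class_eq image_iff) (metis diff_add_cancel)
    show ?thesis
      unfolding mem
      using relation_ideal_add[OF _ d, of "x - p"] relation_ideal_diff[OF _ d, of "x - p'"] by auto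
  qed
  then show "presented_class R p = presented_class R p'" by blast
qed

lemma mem_presented_class: "x \<in> presented_class R p \<longleftrightarrow> presented_class R x = presented_class R p"
  unfolding presented_class_eq_iff
  by (auto simp: presented_class_eq image_iff) (metis diff_add_cancel)

lemma carrier_presented_algebra: "carrier (presented_algebra R) = range (presented_class R)"
  by (auto simp: presented_algebra_def ring.extend_def FactRing_def A_RCOSETS_def' presented_class_def)

lemma mult_presented_algebra:
  "presented_class R p \<otimes>\<^bsub>presented_algebra R\<^esub> presented_class R p' = presented_class R (p * p')"
  using ideal.rcoset_mult_add[OF ideal_relation_ideal, of p p' R]
  by (simp add: presented_algebra_def ring.extend_def FactRing_def presented_class_def)

lemma add_presented_algebra:
  "presented_class R p \<oplus>\<^bsub>presented_algebra R\<^esub> presented_class R p' = presented_class R (p + p')"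
  using abelian_subgroup.a_rcos_sum[OF abelian_subgroupI3[OF ideal.axioms(1)[OF ideal_relation_ideal[of R]]
    ring.is_abelian_group[OF ring_of_free_algebra]], of p p']
  by (simp add: presented_algebra_def ring.extend_def FactRing_def presented_class_def)

lemma one_presented_algebra: "\<one>\<^bsub>presented_algebra R\<^esub> = presented_class R 1"
  by (simp add: presented_algebra_def ring.extend_def FactRing_def presented_class_def)

text \<open>The union in the definition runs over all representatives of a coset. The ideal is
  closed under scalars, so every member of that union is the same coset.\<close>

lemma scal_presented_algebra:
  "c \<odot>\<^bsub>presented_algebra R\<^esub> presented_class R p = presented_class R (c \<bullet>\<^sub>F p)"
proof -
  have "presented_class R (c \<bullet>\<^sub>F x) = presented_class R (c \<bullet>\<^sub>F p)" if "x \<in> presented_class R p" for x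
    using that relation_ideal_scal[of "x - p" R c]
    by (simp add: mem_presented_class presented_class_eq_iff scal_diff_right)
  moreover have "p \<in> presented_class R p" by (simp add: mem_presented_class)
  ultimately have "(\<Union>x\<in>presented_class R p. presented_class R (c \<bullet>\<^sub>F x)) = presented_class R (c \<bullet>\<^sub>F p)"
    by blast
  then show ?thesis
    by (simp add: presented_algebra_def ring.extend_def module.fields_def)
qed

text \<open>A homomorphism into a quotient is determined by the classes of the images of the
  generators: these classes multiply along each word.\<close>

lemma subst_eq_mod:
  assumes "\<And>s. presented_class S (f s) = presented_class S (g s)"
  shows "presented_class S (subst f p) = presented_class S (subst g p)"
proof (induction p rule: free_algebra_induct)
  case (single w c)
  have "presented_class S (prod_list (map f ws)) = presented_class S (prod_list (map g ws))" for ws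
  proof (induction ws)
    case (Cons s ws)
    then show ?case
      using assms[of s] mult_presented_algebra[of S "f s" "prod_list (map f ws)"]
        mult_presented_algebra[of S "g s" "prod_list (map g ws)"] by simp
  qed simp
  then show ?case
    by (simp add: subst_single flip: scal_presented_algebra)
next
  case (add p p')
  then show ?case
    by (simp add: subst_add flip: add_presented_algebra)
qed

lemma subst_comp: "subst f (subst g p) = subst (\<lambda>s. subst f (g s)) p"
proof (induction p rule: free_algebra_induct)
  case (single w c)
  have "subst f (prod_list (map g ws)) = prod_list (map (\<lambda>s. subst f (g s)) ws)" for ws
    by (induction ws) (simp_all add: subst_simps)
  then show ?case by (simp add: subst_single subst_scal)
next
  case (add p p')
  then show ?case by (simp add: subst_add)
qed

lemma subst_gen_id:
  fixes p :: "('f::field, 'x) free_algebra"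
  shows "subst gen p = p"
proof (induction p rule: free_algebra_induct)
  case (single w c)
  have "prod_list (map gen ws) = Poly_Mapping.single (Word ws) (1 :: 'f)" for ws :: "'x list"
    by (induction ws) (simp_all add: gen_def mult_single plus_word_def flip: zero_word_def)
  then show ?case by (simp add: subst_single scal_def mult_single)
next
  case (add p p')
  then show ?case by (simp add: subst_add)
qed

text \<open>The first two assumptions make both substitutions descend to the quotients. The last two
  say that the composites fix the generators modulo the relations, so by \<open>subst_eq_mod\<close>
  they agree with \<open>subst gen\<close>, the identity.\<close>

lemma presented_algebra_iso:
  fixes f :: "'x \<Rightarrow> ('f::field, 'y) free_algebra" and g :: "'y \<Rightarrow> ('f, 'x) free_algebra"
  assumes f: "\<And>l r. (l, r) \<in> R \<Longrightarrow> subst f l - subst f r \<in> relation_ideal S"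
    and g: "\<And>l r. (l, r) \<in> S \<Longrightarrow> subst g l - subst g r \<in> relation_ideal R"
    and gf: "\<And>s. subst g (f s) - gen s \<in> relation_ideal R"
    and fg: "\<And>s. subst f (g s) - gen s \<in> relation_ideal S"
  obtains \<psi> where "\<psi> \<in> alg_iso (presented_algebra R) (presented_algebra S)"
    and "\<And>p. \<psi> (presented_class R p) = presented_class S (subst f p)"
    and "\<And>p. inv_into (carrier (presented_algebra R)) \<psi> (presented_class S p)
          = presented_class R (subst g p)"
proof -
  \<comment> \<open>A representative is chosen arbitrarily; \<open>F\<close> below shows that the
    value does not depend on it.\<close>
  define \<psi> where "\<psi> C = presented_class S (subst f (SOME p. p \<in> C))" for C
  have F: "presented_class S (subst f p) = presented_class S (subst f p')"
    if "presented_class R p = presented_class R p'" for p p'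
    using that subst_relation_ideal[OF f, where p = "p - p'"]
    by (simp add: presented_class_eq_iff subst_diff)
  have G: "presented_class R (subst g p) = presented_class R (subst g p')"
    if "presented_class S p = presented_class S p'" for p p'
    using that subst_relation_ideal[OF g, where p = "p - p'"]
    by (simp add: presented_class_eq_iff subst_diff)
  have \<psi>: "\<psi> (presented_class R p) = presented_class S (subst f p)" for p
  proof -
    have "(SOME x. x \<in> presented_class R p) \<in> presented_class R p"
      by (rule someI[of _ p]) (simp add: mem_presented_class)
    then show ?thesis
      unfolding \<psi>_def by (intro F) (simp add: mem_presented_class)
  qed
  have GF: "presented_class R (subst g (subst f p)) = presented_class R p" for p
    unfolding subst_comp using subst_eq_mod[of R "\<lambda>s. subst g (f s)" gen p] gf
    by (simp add: presented_class_eq_iff subst_gen_id)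
  have FG: "presented_class S (subst f (subst g p)) = presented_class S p" for p
    unfolding subst_comp using subst_eq_mod[of S "\<lambda>s. subst f (g s)" gen p] fg
    by (simp add: presented_class_eq_iff subst_gen_id)
  have inj: "inj_on \<psi> (carrier (presented_algebra R))"
    unfolding inj_on_def carrier_presented_algebra by (simp add: \<psi>) (metis G GF)
  have surj: "\<psi> ` carrier (presented_algebra R) = carrier (presented_algebra S)"
    by (auto simp: carrier_presented_algebra \<psi> image_iff) (metis FG)
  have "\<psi> \<in> ring_hom (presented_algebra R) (presented_algebra S)"
    by (rule ring_hom_memI)
      (auto simp: carrier_presented_algebra \<psi> mult_presented_algebra add_presented_algebra
        one_presented_algebra subst_simps)
  then have "\<psi> \<in> alg_iso (presented_algebra R) (presented_algebra S)"
    using inj surj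
    by (auto simp: alg_iso_def ring_iso_def bij_betw_def carrier_presented_algebra \<psi>
        scal_presented_algebra subst_simps)
  moreover have "inv_into (carrier (presented_algebra R)) \<psi> (presented_class S p)
      = presented_class R (subst g p)" for p
    by (rule inv_into_f_eq[OF inj]) (simp_all add: carrier_presented_algebra \<psi> FG)
  ultimately show ?thesis using that \<psi> by blast
qed

lemma alg_iso_comp:
  assumes "h \<in> alg_iso L M" and "k \<in> alg_iso M N"
  shows "k \<circ> h \<in> alg_iso L N"
proof -
  have "h u \<in> carrier M" if "u \<in> carrier L" for u
    using assms(1) that by (auto simp: alg_iso_def ring_iso_def bij_betw_def)
  then show ?thesis
    using assms ring_iso_set_trans[of h L M k N] by (auto simp: alg_iso_def)
qed

lemma relation_ideal_scal_cancel:
  assumes "c \<bullet>\<^sub>F p \<in> relation_ideal R" and "c \<noteq> 0"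
  shows "p \<in> relation_ideal R"
  using relation_ideal_scal[OF assms(1), of "inverse c"] assms(2) by (simp add: scal_scal scal_one)

section \<open>The generators of the Chevalley presentation in terms of A and y\<close>

text \<open>Cancellation rules for scalars in which \<open>x\<close> and its inverse stand up to two
  factors apart, as they do after scalars have been merged.\<close>

lemma mult_inverse_cancel:
  fixes x y z :: "'f::field"
  assumes "x \<noteq> 0"
  shows "x * (inverse x * y) = y" and "x * (y * inverse x) = y" and "x * (y * (inverse x * z)) = y * z"
    and "x * (y * (z * inverse x)) = y * z"
  using assms by (simp_all add: mult.left_commute)

lemma q_diff_squares: "q ^ 2 - inverse q ^ 2 = (q - inverse q) * (q + inverse q)" for q :: "'f::field"
  by (simp add: algebra_simps power2_eq_square)

text \<open>Multiplying q^2 - q^-2 by q^2 gives q^4 - 1, and q^2 - q^-2 has the other two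
  expressions as factors. So the single condition on q makes every denominator nonzero.\<close>

lemma q_diff_nonzero:
  fixes q :: "'f::field"
  assumes "q \<noteq> 0" and "q ^ 4 \<noteq> 1"
  shows "q - inverse q \<noteq> 0" and "q + inverse q \<noteq> 0" and "q ^ 2 - inverse q ^ 2 \<noteq> 0"
proof -
  have "q ^ 2 * (q ^ 2 - inverse q ^ 2) = q ^ 4 - 1"
    using assms(1) by (simp add: right_diff_distrib power_inverse flip: power_add)
  then show "q ^ 2 - inverse q ^ 2 \<noteq> 0" using assms(2) by auto
  then show "q - inverse q \<noteq> 0" and "q + inverse q \<noteq> 0" by (auto simp: q_diff_squares)
qed

text \<open>\<open>nu q a (A y) (y A)\<close> is the image of \<open>\<nu>\<^sub>x\<close>. The image of \<open>\<nu>\<^sub>z\<close> is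
  \<open>nu q\<^sup>-\<^sup>1 a\<^sup>-\<^sup>1 (A y) (y A)\<close>, so that facts about the former carry over to the latter.\<close>

definition nu :: "'f::field \<Rightarrow> 'f \<Rightarrow> ('f, 'x) free_algebra \<Rightarrow> ('f, 'x) free_algebra \<Rightarrow> ('f, 'x) free_algebra"
  where "nu q a u v = (inverse a * ((a + inverse a) / (q + inverse q))) \<bullet>\<^sub>F 1
    - inverse a \<bullet>\<^sub>F (1 / (q ^ 2 - inverse q ^ 2)) \<bullet>\<^sub>F (q \<bullet>\<^sub>F u - inverse q \<bullet>\<^sub>F v)"

text \<open>Inverting q flips the sign of q^2 - q^-2; exchanging \<open>u\<close> and
  \<open>v\<close> in the bracket absorbs this sign.\<close>

lemma nu_inverse:
  "nu (inverse q) (inverse a) u v = (a * ((a + inverse a) / (q + inverse q))) \<bullet>\<^sub>F 1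
    - a \<bullet>\<^sub>F (1 / (q ^ 2 - inverse q ^ 2)) \<bullet>\<^sub>F (q \<bullet>\<^sub>F v - inverse q \<bullet>\<^sub>F u)"
proof -
  have "1 / (inverse q ^ 2 - q ^ 2) = - (1 / (q ^ 2 - inverse q ^ 2))"
    by (metis minus_diff_eq minus_divide_right)
  then show ?thesis
    by (simp add: nu_def scal_simps algebra_simps)
qed

text \<open>\<open>nu\<close> is affine in its last two arguments, so the constant term cancels in
  the difference.\<close>

lemma nu_cong_mod:
  assumes "u - u' \<in> relation_ideal R" and "v - v' \<in> relation_ideal R"
  shows "nu q a u v - nu q a u' v' \<in> relation_ideal R"
proof -
  have "nu q a u v - nu q a u' v' = - (inverse a \<bullet>\<^sub>F (1 / (q ^ 2 - inverse q ^ 2)) \<bullet>\<^sub>F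
      (q \<bullet>\<^sub>F (u - u') - inverse q \<bullet>\<^sub>F (v - v')))"
    by (simp add: nu_def scal_diff_right)
  then show ?thesis
    using assms by (auto intro!: relation_ideal_intros)
qed

text \<open>The two arguments are what A y and y A become modulo the Chevalley relations. In q u -
  q^-1 v the terms in \<open>m\<close> cancel, \<open>n\<close> receives the coefficient -a (q^2 -
  q^-2), and the constant cancels against that of \<open>nu\<close>.\<close>

lemma nu_eq:
  assumes "q \<noteq> 0" and "q ^ 4 \<noteq> 1" and "a \<noteq> 0"
  shows "nu q a (a \<bullet>\<^sub>F (1 - q \<bullet>\<^sub>F n) + inverse a \<bullet>\<^sub>F (1 - inverse q \<bullet>\<^sub>F m))
    (a \<bullet>\<^sub>F (1 - inverse q \<bullet>\<^sub>F n) + inverse a \<bullet>\<^sub>F (1 - q \<bullet>\<^sub>F m)) = n"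
proof -
  define \<alpha> where "\<alpha> = inverse a * ((a + inverse a) / (q + inverse q))"
  define \<beta> where "\<beta> = inverse a * (1 / (q ^ 2 - inverse q ^ 2))"
  have 1: "\<alpha> - \<beta> * (a + inverse a) * (q - inverse q) = 0"
    using q_diff_nonzero(1,2)[OF assms(1,2)] by (simp add: \<alpha>_def \<beta>_def q_diff_squares)
  have 2: "\<beta> * a * (q ^ 2 - inverse q ^ 2) = 1"
    using assms q_diff_nonzero[OF assms(1,2)] by (simp add: \<beta>_def)
  have "nu q a (a \<bullet>\<^sub>F (1 - q \<bullet>\<^sub>F n) + inverse a \<bullet>\<^sub>F (1 - inverse q \<bullet>\<^sub>F m))
      (a \<bullet>\<^sub>F (1 - inverse q \<bullet>\<^sub>F n) + inverse a \<bullet>\<^sub>F (1 - q \<bullet>\<^sub>F m)) =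
    (\<alpha> - \<beta> * (a + inverse a) * (q - inverse q)) \<bullet>\<^sub>F 1 + (\<beta> * a * (q ^ 2 - inverse q ^ 2)) \<bullet>\<^sub>F n"
    unfolding nu_def \<alpha>_def[symmetric] scal_scal[of "inverse a" "1 / (q ^ 2 - inverse q ^ 2)"] \<beta>_def[symmetric]
    using assms(1) by (simp add: scal_simps algebra_simps power2_eq_square)
  then show ?thesis
    by (simp add: 1 2 scal_one scal_zero_left)
qed

text \<open>The converse of \<open>nu_eq\<close>: in this combination the terms in \<open>v\<close>
  and the constants cancel. With \<open>u\<close> = A y it recovers A y from the two
  \<open>nu\<close> expressions.\<close>

lemma nu_inverts:
  assumes "q \<noteq> 0" and "q ^ 4 \<noteq> 1" and "a \<noteq> 0"
  shows "a \<bullet>\<^sub>F (1 - q \<bullet>\<^sub>F nu q a u v) + inverse a \<bullet>\<^sub>F (1 - inverse q \<bullet>\<^sub>F nu (inverse q) (inverse a) u v) = u"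
proof -
  define \<gamma> where "\<gamma> = (a + inverse a) / (q + inverse q)"
  define \<delta> where "\<delta> = 1 / (q ^ 2 - inverse q ^ 2)"
  have 1: "a + inverse a - (q + inverse q) * \<gamma> = 0"
    using q_diff_nonzero[OF assms(1,2)] by (simp add: \<gamma>_def)
  have 2: "\<delta> * (q ^ 2 - inverse q ^ 2) = 1"
    using q_diff_nonzero[OF assms(1,2)] by (simp add: \<delta>_def)
  have "a \<bullet>\<^sub>F (1 - q \<bullet>\<^sub>F nu q a u v) + inverse a \<bullet>\<^sub>F (1 - inverse q \<bullet>\<^sub>F nu (inverse q) (inverse a) u v) =
    (a + inverse a - (q + inverse q) * \<gamma>) \<bullet>\<^sub>F 1 + (\<delta> * (q ^ 2 - inverse q ^ 2)) \<bullet>\<^sub>F u"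
    unfolding nu_inverse unfolding nu_def \<gamma>_def[symmetric] \<delta>_def[symmetric]
    using assms by (simp add: mult_inverse_cancel scal_simps algebra_simps power2_eq_square)
  then show ?thesis
    by (simp add: 1 2 scal_one scal_zero_left)
qed

text \<open>\<open>A\<close> and \<open>y\<close> range over any free algebra, so that the
  identities below serve for the generators as well as for their images. The double minus keeps the
  literal form \<open>l - r\<close> of the relation.\<close>

definition Ay_linear_rel :: "'f::field \<Rightarrow> 'f \<Rightarrow> ('f, 'x) free_algebra \<Rightarrow> ('f, 'x) free_algebra \<Rightarrow> ('f, 'x) free_algebra"
  where "Ay_linear_rel q a A y = y ^ 2 * A - (q ^ 2 + inverse q ^ 2) \<bullet>\<^sub>F (y * A * y) + A * y ^ 2
    - - (((a + inverse a) * (q - inverse q) ^ 2) \<bullet>\<^sub>F y)"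

definition Ay_quadratic_rel :: "'f::field \<Rightarrow> 'f \<Rightarrow> ('f, 'x) free_algebra \<Rightarrow> ('f, 'x) free_algebra \<Rightarrow> ('f, 'x) free_algebra"
  where "Ay_quadratic_rel q a A y =
    A * y ^ 2 * A + A * y * A * y + y * A * y * A - q_number 3 q \<bullet>\<^sub>F (y * A ^ 2 * y)
      + ((a + inverse a) * (q - inverse q) ^ 2) \<bullet>\<^sub>F (A * y + y * A)
    - (((q ^ 2 - inverse q ^ 2) ^ 2) \<bullet>\<^sub>F (y ^ 2)
      + ((a * q - inverse a * inverse q) * (a * inverse q - inverse a * q)
             * (q - inverse q) ^ 2) \<bullet>\<^sub>F 1)"

text \<open>Since y (A y) = (y A) y, only the monomials y^2 A, y A y and A y^2 arise in degree
  three, with coefficients proportional to those in the relation.\<close>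

lemma nu_q_commute:
  assumes "q \<noteq> 0" and "q ^ 4 \<noteq> 1" and "a \<noteq> 0"
  shows "y * nu q a (A * y) (y * A) - (inverse q ^ 2) \<bullet>\<^sub>F (nu q a (A * y) (y * A) * y)
    = (inverse a * inverse q / (q ^ 2 - inverse q ^ 2)) \<bullet>\<^sub>F Ay_linear_rel q a A y"
proof -
  define \<alpha> where "\<alpha> = inverse a * ((a + inverse a) / (q + inverse q))"
  define \<beta> where "\<beta> = inverse a * (1 / (q ^ 2 - inverse q ^ 2))"
  \<comment> \<open>The constant term of \<open>nu\<close> contributes this multiple of y; it has to
    match the right side of the linear relation.\<close>
  have 1: "\<alpha> - inverse q ^ 2 * \<alpha> = inverse q * \<beta> * ((a + inverse a) * (q - inverse q) ^ 2)"
  proof -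
    have "\<alpha> - inverse q ^ 2 * \<alpha> = inverse q * (q - inverse q) * \<alpha>"
      using assms(1) by (simp add: algebra_simps power2_eq_square)
    also have "\<dots> = inverse q * \<beta> * ((a + inverse a) * (q - inverse q) ^ 2)"
      using q_diff_nonzero(1,2)[OF assms(1,2)]
      by (simp add: \<alpha>_def \<beta>_def q_diff_squares power2_eq_square[of "q - inverse q"])
    finally show ?thesis .
  qed
  have "y * nu q a (A * y) (y * A) - (inverse q ^ 2) \<bullet>\<^sub>F (nu q a (A * y) (y * A) * y) =
    (\<alpha> - inverse q ^ 2 * \<alpha>) \<bullet>\<^sub>F y + (inverse q * \<beta>) \<bullet>\<^sub>F (y ^ 2 * A - (q ^ 2 + inverse q ^ 2) \<bullet>\<^sub>F (y * A * y) + A * y ^ 2)"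
    unfolding nu_def \<alpha>_def[symmetric] scal_scal[of "inverse a" "1 / (q ^ 2 - inverse q ^ 2)"] \<beta>_def[symmetric]
    using assms(1) by (simp add: scal_simps algebra_simps power2_eq_square)
  also have "\<dots> = (inverse q * \<beta>) \<bullet>\<^sub>F Ay_linear_rel q a A y"
    unfolding 1 Ay_linear_rel_def by (simp add: scal_add_right scal_scal)
  finally show ?thesis by (simp add: \<beta>_def mult.commute)
qed

text \<open>This invariance transfers \<open>nu_q_commute\<close> from the image of
  \<open>nux\<close> to that of \<open>nuz\<close>.\<close>

lemma Ay_linear_rel_inverse: "Ay_linear_rel (inverse q) (inverse a) A y = Ay_linear_rel q a A y"
  by (simp add: Ay_linear_rel_def power2_commute[of q] add.commute)

text \<open>The prefactors a and a^-1 cancel in both products. What remains is the q-commutator of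
  two affine expressions in A y and y A, compared degree by degree.\<close>

lemma nu_q_commutator:
  assumes "q \<noteq> 0" and "q ^ 4 \<noteq> 1" and "a \<noteq> 0"
  shows "(1 / (q - inverse q)) \<bullet>\<^sub>F
      (q \<bullet>\<^sub>F (nu (inverse q) (inverse a) (A * y) (y * A) * nu q a (A * y) (y * A))
      - inverse q \<bullet>\<^sub>F (nu q a (A * y) (y * A) * nu (inverse q) (inverse a) (A * y) (y * A))) - (1 - y ^ 2)
    = (- (1 / (q ^ 2 - inverse q ^ 2) ^ 2)) \<bullet>\<^sub>F Ay_quadratic_rel q a A y"
proof -
  define \<gamma> where "\<gamma> = (a + inverse a) / (q + inverse q)"
  define \<delta> where "\<delta> = 1 / (q ^ 2 - inverse q ^ 2)"
  define c where "c = 1 / (q - inverse q)"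
  define k where "k = (a * q - inverse a * inverse q) * (a * inverse q - inverse a * q) * (q - inverse q) ^ 2"
  define e where "e = (a + inverse a) * (q - inverse q) ^ 2"
  have c: "c * (q - inverse q) = 1"
    using q_diff_nonzero[OF assms(1,2)] by (simp add: c_def)
  have a: "inverse a * a = 1" "a * inverse a = 1"
    using assms(3) by simp_all
  have \<delta>: "\<delta> ^ 2 * (q ^ 2 - inverse q ^ 2) ^ 2 = 1"
    using q_diff_nonzero[OF assms(1,2)] by (simp add: \<delta>_def power_one_over)
  have 1: "\<gamma> ^ 2 = 1 + \<delta> ^ 2 * k"
  proof -
    have "(a + inverse a) ^ 2 = (q + inverse q) ^ 2
        + (a * q - inverse a * inverse q) * (a * inverse q - inverse a * q)"
      using assms(1,3) by (simp add: field_simps power2_eq_square)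
    then show ?thesis
      using q_diff_nonzero(1,2)[OF assms(1,2)]
      unfolding \<gamma>_def \<delta>_def k_def q_diff_squares power_divide power_mult_distrib
      by (simp add: add_divide_distrib)
  qed
  \<comment> \<open>The coefficient of A y + y A.\<close>
  have 2: "\<gamma> * \<delta> * (q - inverse q) = \<delta> ^ 2 * e"
    using q_diff_nonzero(1,2)[OF assms(1,2)]
    unfolding \<gamma>_def \<delta>_def e_def q_diff_squares by (simp add: power2_eq_square)
  \<comment> \<open>The coefficient of (y A)(A y); the other three products of A y and y A all carry
    -(q - q^-1) before division.\<close>
  have 3: "c * (q ^ 3 - inverse q ^ 3) = q_number 3 q"
    by (simp add: c_def q_number_def)
  let ?u = "A * y" and ?v = "y * A"
  have "nu (inverse q) (inverse a) ?u ?v = a \<bullet>\<^sub>F (\<gamma> \<bullet>\<^sub>F 1 - \<delta> \<bullet>\<^sub>F (q \<bullet>\<^sub>F ?v - inverse q \<bullet>\<^sub>F ?u))"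
    and "nu q a ?u ?v = inverse a \<bullet>\<^sub>F (\<gamma> \<bullet>\<^sub>F 1 - \<delta> \<bullet>\<^sub>F (q \<bullet>\<^sub>F ?u - inverse q \<bullet>\<^sub>F ?v))"
    unfolding nu_inverse unfolding nu_def \<gamma>_def[symmetric] \<delta>_def[symmetric]
    by (simp_all only: scal_diff_right[of a] scal_diff_right[of "inverse a"] scal_scal)
  then have MN: "nu (inverse q) (inverse a) ?u ?v * nu q a ?u ?v =
      (\<gamma> \<bullet>\<^sub>F 1 - \<delta> \<bullet>\<^sub>F (q \<bullet>\<^sub>F ?v - inverse q \<bullet>\<^sub>F ?u)) * (\<gamma> \<bullet>\<^sub>F 1 - \<delta> \<bullet>\<^sub>F (q \<bullet>\<^sub>F ?u - inverse q \<bullet>\<^sub>F ?v))"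
    and NM: "nu q a ?u ?v * nu (inverse q) (inverse a) ?u ?v =
      (\<gamma> \<bullet>\<^sub>F 1 - \<delta> \<bullet>\<^sub>F (q \<bullet>\<^sub>F ?u - inverse q \<bullet>\<^sub>F ?v)) * (\<gamma> \<bullet>\<^sub>F 1 - \<delta> \<bullet>\<^sub>F (q \<bullet>\<^sub>F ?v - inverse q \<bullet>\<^sub>F ?u))"
    by (simp_all only: mult_scal_left mult_scal_right scal_scal a scal_one)
  have "c \<bullet>\<^sub>F (q \<bullet>\<^sub>F (nu (inverse q) (inverse a) ?u ?v * nu q a ?u ?v)
        - inverse q \<bullet>\<^sub>F (nu q a ?u ?v * nu (inverse q) (inverse a) ?u ?v))
    = c \<bullet>\<^sub>F ((q - inverse q) \<bullet>\<^sub>F (\<gamma> ^ 2) \<bullet>\<^sub>F 1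
       - ((q - inverse q) \<bullet>\<^sub>F (\<gamma> * \<delta> * (q - inverse q)) \<bullet>\<^sub>F (?u + ?v))
       + (\<delta> ^ 2) \<bullet>\<^sub>F ((q ^ 3 - inverse q ^ 3) \<bullet>\<^sub>F (?v * ?u)
          - (q - inverse q) \<bullet>\<^sub>F (?v * ?v + ?u * ?u + ?u * ?v)))"
    unfolding MN NM using assms(1)
    by (simp add: mult_inverse_cancel scal_simps algebra_simps power2_eq_square power3_eq_cube)
  also have "\<dots> = (c * (q - inverse q)) \<bullet>\<^sub>F (\<gamma> ^ 2) \<bullet>\<^sub>F 1
       - (c * (q - inverse q)) \<bullet>\<^sub>F (\<gamma> * \<delta> * (q - inverse q)) \<bullet>\<^sub>F (?u + ?v)
       + (\<delta> ^ 2) \<bullet>\<^sub>F ((c * (q ^ 3 - inverse q ^ 3)) \<bullet>\<^sub>F (?v * ?u)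
          - (c * (q - inverse q)) \<bullet>\<^sub>F (?v * ?v + ?u * ?u + ?u * ?v))"
    by (simp add: scal_add_right scal_diff_right scal_scal mult.left_commute mult.assoc)
  also have "\<dots> = (1 + \<delta> ^ 2 * k) \<bullet>\<^sub>F 1 - (\<delta> ^ 2 * e) \<bullet>\<^sub>F (?u + ?v)
       + (\<delta> ^ 2) \<bullet>\<^sub>F (q_number 3 q \<bullet>\<^sub>F (?v * ?u) - (?v * ?v + ?u * ?u + ?u * ?v))"
    unfolding c 1 2 3 by (simp add: scal_one)
  \<comment> \<open>The coefficient 1 of y^2 is written as \<delta>^2 (q^2 - q^-2)^2, so that
    \<delta>^2 can be factored out of every term.\<close>
  also have "\<dots> - (1 - (\<delta> ^ 2 * (q ^ 2 - inverse q ^ 2) ^ 2) \<bullet>\<^sub>F y ^ 2) = (- (\<delta> ^ 2)) \<bullet>\<^sub>F Ay_quadratic_rel q a A y"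
    unfolding Ay_quadratic_rel_def k_def[symmetric] e_def[symmetric]
    by (simp add: scal_add_right scal_diff_right scal_minus_left scal_add_left scal_scal scal_one
        mult.assoc power2_eq_square[of y] power2_eq_square[of A])
  finally show ?thesis
    unfolding \<delta> c_def by (simp add: \<delta>_def scal_one power_one_over)
qed

section \<open>Congruences modulo a relation ideal, each certified by an explicit combination of
  ideal elements\<close>

lemma conj_mod:
  assumes "y * yi - 1 \<in> relation_ideal R" and "yi * y - 1 \<in> relation_ideal R"
    and "y * n - c \<bullet>\<^sub>F (n * y) \<in> relation_ideal R"
  shows "y * n * yi - c \<bullet>\<^sub>F n \<in> relation_ideal R"
proof -
  have "y * n * yi - c \<bullet>\<^sub>F n = (y * n - c \<bullet>\<^sub>F (n * y)) * yi + c \<bullet>\<^sub>F (n * (y * yi - 1))"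
    by (simp add: mult_inverse_cancel scal_simps algebra_simps)
  then show ?thesis using assms by (simp only: relation_ideal_intros)
qed

lemma commute_mod:
  assumes "y * yi - 1 \<in> relation_ideal R" and "yi * y - 1 \<in> relation_ideal R"
    and "y * n * yi - c \<bullet>\<^sub>F n \<in> relation_ideal R"
  shows "y * n - c \<bullet>\<^sub>F (n * y) \<in> relation_ideal R"
proof -
  have "y * n - c \<bullet>\<^sub>F (n * y) = (y * n * yi - c \<bullet>\<^sub>F n) * y - y * n * (yi * y - 1)"
    by (simp add: mult_inverse_cancel scal_simps algebra_simps)
  then show ?thesis using assms by (simp only: relation_ideal_intros)
qed

text \<open>Multiplying the commutation relation by \<open>yi\<close> on both sides and scaling by
  -d moves \<open>yi\<close> past \<open>n\<close>, up to multiples of the two inverse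
  relations.\<close>

lemma commute_inverse_mod:
  assumes "y * yi - 1 \<in> relation_ideal R" and "yi * y - 1 \<in> relation_ideal R"
    and "y * n - c \<bullet>\<^sub>F (n * y) \<in> relation_ideal R" and "c * d = 1"
  shows "yi * n - d \<bullet>\<^sub>F (n * yi) \<in> relation_ideal R"
proof -
  have dc: "d * c = 1" using assms(4) by (simp add: mult.commute)
  have "yi * n - d \<bullet>\<^sub>F (n * yi) = - (d \<bullet>\<^sub>F (yi * (y * n - c \<bullet>\<^sub>F (n * y)) * yi))
      + d \<bullet>\<^sub>F ((yi * y - 1) * n * yi) - yi * n * (y * yi - 1)"
    by (simp add: mult_inverse_cancel scal_simps algebra_simps dc assms(4))
  then show ?thesis using assms by (simp only: relation_ideal_intros)
qed

lemma q_commutator_mod: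
  assumes "p - p' \<in> relation_ideal R" and "r - r' \<in> relation_ideal R"
    and "c \<bullet>\<^sub>F (q \<bullet>\<^sub>F p' - d \<bullet>\<^sub>F r') - s \<in> relation_ideal R"
  shows "c \<bullet>\<^sub>F (q \<bullet>\<^sub>F p - d \<bullet>\<^sub>F r) - s \<in> relation_ideal R"
proof -
  have "c \<bullet>\<^sub>F (q \<bullet>\<^sub>F p - d \<bullet>\<^sub>F r) - s =
      (c \<bullet>\<^sub>F (q \<bullet>\<^sub>F p' - d \<bullet>\<^sub>F r') - s) + c \<bullet>\<^sub>F (q \<bullet>\<^sub>F (p - p') - d \<bullet>\<^sub>F (r - r'))"
    by (simp add: scal_add_right scal_diff_right)
  then show ?thesis using assms by (simp only: relation_ideal_intros)
qed

lemma mult_mod: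
  assumes "p - p' \<in> relation_ideal R" and "r - r' \<in> relation_ideal R"
  shows "p * r - p' * r' \<in> relation_ideal R"
proof -
  have "p * r - p' * r' = (p - p') * r + p' * (r - r')"
    by (simp add: algebra_simps)
  then show ?thesis using assms by (simp only: relation_ideal_intros)
qed

section \<open>The isomorphisms\<close>

lemma Ay_relation_ideal:
  fixes q a :: "'f::field"
  defines "I \<equiv> relation_ideal (Ay_relations q a)"
  shows "gen Ay_y * gen Ay_yinv - 1 \<in> I" and "gen Ay_yinv * gen Ay_y - 1 \<in> I"
    and "Ay_linear_rel q a (gen Ay_A) (gen Ay_y) \<in> I" and "Ay_quadratic_rel q a (gen Ay_A) (gen Ay_y) \<in> I"
  unfolding I_def Ay_linear_rel_def Ay_quadratic_rel_def
  by (intro relation_ideal_memI; simp add: Ay_relations_def Let_def)+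

lemma chevalley_relation_ideal:
  fixes q :: "'f::field"
  defines "I \<equiv> relation_ideal (chevalley_relations q)"
  shows "gen Ch_y * gen Ch_yinv - 1 \<in> I" and "gen Ch_yinv * gen Ch_y - 1 \<in> I"
    and "gen Ch_y * gen Ch_nux * gen Ch_yinv - (inverse q ^ 2) \<bullet>\<^sub>F gen Ch_nux \<in> I"
    and "gen Ch_y * gen Ch_nuz * gen Ch_yinv - (q ^ 2) \<bullet>\<^sub>F gen Ch_nuz \<in> I"
    and "(1 / (q - inverse q)) \<bullet>\<^sub>F (q \<bullet>\<^sub>F (gen Ch_nuz * gen Ch_nux)
      - inverse q \<bullet>\<^sub>F (gen Ch_nux * gen Ch_nuz)) - (1 - gen Ch_y ^ 2) \<in> I"
  unfolding I_def by (intro relation_ideal_memI; simp add: chevalley_relations_def Let_def)+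

lemma equitable_relation_ideal:
  fixes q :: "'f::field"
  defines "I \<equiv> relation_ideal (equitable_relations q)"
  shows "gen Eq_y * gen Eq_yinv - 1 \<in> I" and "gen Eq_yinv * gen Eq_y - 1 \<in> I"
    and "(1 / (q - inverse q)) \<bullet>\<^sub>F (q \<bullet>\<^sub>F (gen Eq_x * gen Eq_y) - inverse q \<bullet>\<^sub>F (gen Eq_y * gen Eq_x)) - 1 \<in> I"
    and "(1 / (q - inverse q)) \<bullet>\<^sub>F (q \<bullet>\<^sub>F (gen Eq_y * gen Eq_z) - inverse q \<bullet>\<^sub>F (gen Eq_z * gen Eq_y)) - 1 \<in> I"
    and "(1 / (q - inverse q)) \<bullet>\<^sub>F (q \<bullet>\<^sub>F (gen Eq_z * gen Eq_x) - inverse q \<bullet>\<^sub>F (gen Eq_x * gen Eq_z)) - 1 \<in> I"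
  unfolding I_def by (intro relation_ideal_memI; simp add: equitable_relations_def Let_def)+

primrec Ay_to_chevalley :: "'f::field \<Rightarrow> 'f \<Rightarrow> Ay_gen \<Rightarrow> ('f, chevalley_gen) free_algebra" where
  "Ay_to_chevalley q a Ay_A = a \<bullet>\<^sub>F ((1 - q \<bullet>\<^sub>F gen Ch_nux) * gen Ch_yinv)
     + inverse a \<bullet>\<^sub>F ((1 - inverse q \<bullet>\<^sub>F gen Ch_nuz) * gen Ch_yinv)"
| "Ay_to_chevalley q a Ay_y = gen Ch_y"
| "Ay_to_chevalley q a Ay_yinv = gen Ch_yinv"

primrec chevalley_to_Ay :: "'f::field \<Rightarrow> 'f \<Rightarrow> chevalley_gen \<Rightarrow> ('f, Ay_gen) free_algebra" where
  "chevalley_to_Ay q a Ch_nux = nu q a (gen Ay_A * gen Ay_y) (gen Ay_y * gen Ay_A)"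
| "chevalley_to_Ay q a Ch_y = gen Ay_y"
| "chevalley_to_Ay q a Ch_yinv = gen Ay_yinv"
| "chevalley_to_Ay q a Ch_nuz = nu (inverse q) (inverse a) (gen Ay_A * gen Ay_y) (gen Ay_y * gen Ay_A)"

text \<open>Of the two expressions for each of \<open>nux\<close> and \<open>nuz\<close>, the one
  with y on the right is taken; multiplying by y^-1 on the right then solves for z and x, which
  gives \<open>equitable_to_chevalley\<close>.\<close>

primrec chevalley_to_equitable :: "'f::field \<Rightarrow> chevalley_gen \<Rightarrow> ('f, equitable_gen) free_algebra" where
  "chevalley_to_equitable q Ch_nux = inverse q \<bullet>\<^sub>F (1 - gen Eq_z * gen Eq_y)"
| "chevalley_to_equitable q Ch_y = gen Eq_y"
| "chevalley_to_equitable q Ch_yinv = gen Eq_yinv"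
| "chevalley_to_equitable q Ch_nuz = q \<bullet>\<^sub>F (1 - gen Eq_x * gen Eq_y)"

primrec equitable_to_chevalley :: "'f::field \<Rightarrow> equitable_gen \<Rightarrow> ('f, chevalley_gen) free_algebra" where
  "equitable_to_chevalley q Eq_x = (1 - inverse q \<bullet>\<^sub>F gen Ch_nuz) * gen Ch_yinv"
| "equitable_to_chevalley q Eq_y = gen Ch_y"
| "equitable_to_chevalley q Eq_yinv = gen Ch_yinv"
| "equitable_to_chevalley q Eq_z = (1 - q \<bullet>\<^sub>F gen Ch_nux) * gen Ch_yinv"

lemma subst_nu: "subst f (nu q a u v) = nu q a (subst f u) (subst f v)"
  by (simp add: nu_def subst_simps)

section \<open>The Chevalley generators versus A and y\<close>

lemma chevalley_commute:
  fixes q :: "'f::field"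
  assumes "q \<noteq> 0"
  defines "I \<equiv> relation_ideal (chevalley_relations q)"
  shows "gen Ch_y * gen Ch_nux - (inverse q ^ 2) \<bullet>\<^sub>F (gen Ch_nux * gen Ch_y) \<in> I"
    and "gen Ch_y * gen Ch_nuz - (q ^ 2) \<bullet>\<^sub>F (gen Ch_nuz * gen Ch_y) \<in> I"
    and "gen Ch_yinv * gen Ch_nux - (q ^ 2) \<bullet>\<^sub>F (gen Ch_nux * gen Ch_yinv) \<in> I"
    and "gen Ch_yinv * gen Ch_nuz - (inverse q ^ 2) \<bullet>\<^sub>F (gen Ch_nuz * gen Ch_yinv) \<in> I"
proof -
  note C = chevalley_relation_ideal[of q]
  show nux: "gen Ch_y * gen Ch_nux - (inverse q ^ 2) \<bullet>\<^sub>F (gen Ch_nux * gen Ch_y) \<in> I"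
    unfolding I_def by (rule commute_mod[OF C(1,2,3)])
  show nuz: "gen Ch_y * gen Ch_nuz - (q ^ 2) \<bullet>\<^sub>F (gen Ch_nuz * gen Ch_y) \<in> I"
    unfolding I_def by (rule commute_mod[OF C(1,2,4)])
  have "inverse q ^ 2 * q ^ 2 = 1" "q ^ 2 * inverse q ^ 2 = 1"
    using assms(1) by (simp_all flip: power_mult_distrib)
  then show "gen Ch_yinv * gen Ch_nux - (q ^ 2) \<bullet>\<^sub>F (gen Ch_nux * gen Ch_yinv) \<in> I"
    and "gen Ch_yinv * gen Ch_nuz - (inverse q ^ 2) \<bullet>\<^sub>F (gen Ch_nuz * gen Ch_yinv) \<in> I"
    using commute_inverse_mod[OF C(1,2) nux[unfolded I_def]] commute_inverse_mod[OF C(1,2) nuz[unfolded I_def]]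
    unfolding I_def by blast+
qed

lemma Ay_chevalley_Ay:
  assumes "q \<noteq> 0" and "q ^ 4 \<noteq> 1" and "a \<noteq> 0"
  shows "subst (chevalley_to_Ay q a) (Ay_to_chevalley q a s) - gen s \<in> relation_ideal (Ay_relations q a)"
proof (cases s)
  case Ay_A
  let ?u = "gen Ay_A * gen Ay_y" and ?v = "gen Ay_y * gen Ay_A"
  have "subst (chevalley_to_Ay q a) (Ay_to_chevalley q a Ay_A) =
      (a \<bullet>\<^sub>F (1 - q \<bullet>\<^sub>F nu q a ?u ?v)
        + inverse a \<bullet>\<^sub>F (1 - inverse q \<bullet>\<^sub>F nu (inverse q) (inverse a) ?u ?v)) * gen Ay_yinv"
    by (simp add: subst_simps mult_scal_left distrib_right)
  also have "\<dots> - gen Ay_A = gen Ay_A * (gen Ay_y * gen Ay_yinv - 1)"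
    unfolding nu_inverts[OF assms] by (simp add: algebra_simps)
  finally show ?thesis
    using Ay_A Ay_relation_ideal(1)[of q a] by (simp only: relation_ideal_mult_left)
qed (simp_all add: subst_gen relation_ideal_zero)

lemma chevalley_Ay_chevalley:
  assumes "q \<noteq> 0" and "q ^ 4 \<noteq> 1" and "a \<noteq> 0"
  shows "subst (Ay_to_chevalley q a) (chevalley_to_Ay q a s) - gen s \<in> relation_ideal (chevalley_relations q)"
proof -
  note C = chevalley_relation_ideal[of q]
  let ?A = "Ay_to_chevalley q a Ay_A"
  let ?y = "gen Ch_y :: ('a, chevalley_gen) free_algebra" and ?yi = "gen Ch_yinv :: ('a, chevalley_gen) free_algebra"
  let ?n = "gen Ch_nux :: ('a, chevalley_gen) free_algebra" and ?m = "gen Ch_nuz :: ('a, chevalley_gen) free_algebra"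
  \<comment> \<open>The residues of A y and y A: y^-1 cancels in the first, and conjugation by y
    scales \<open>?n\<close> by q^-2 and \<open>?m\<close> by q^2 in the second.\<close>
  let ?U = "a \<bullet>\<^sub>F (1 - q \<bullet>\<^sub>F ?n) + inverse a \<bullet>\<^sub>F (1 - inverse q \<bullet>\<^sub>F ?m)"
  let ?V = "a \<bullet>\<^sub>F (1 - inverse q \<bullet>\<^sub>F ?n) + inverse a \<bullet>\<^sub>F (1 - q \<bullet>\<^sub>F ?m)"
  have "?A * ?y - ?U = ?U * (?yi * ?y - 1)"
    by (simp add: mult_inverse_cancel scal_simps algebra_simps)
  then have u: "?A * ?y - ?U \<in> relation_ideal (chevalley_relations q)"
    using C by (simp only: relation_ideal_intros)
  have "?y * ?A - ?V = a \<bullet>\<^sub>F ((?y * ?yi - 1) - q \<bullet>\<^sub>F (?y * ?n * ?yi - (inverse q ^ 2) \<bullet>\<^sub>F ?n))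
      + inverse a \<bullet>\<^sub>F ((?y * ?yi - 1) - inverse q \<bullet>\<^sub>F (?y * ?m * ?yi - (q ^ 2) \<bullet>\<^sub>F ?m))"
    using assms(1) by (simp add: mult_inverse_cancel scal_simps algebra_simps power2_eq_square)
  then have v: "?y * ?A - ?V \<in> relation_ideal (chevalley_relations q)"
    using C by (simp only: relation_ideal_intros)
  have n: "nu q a ?U ?V = ?n"
    by (rule nu_eq[OF assms])
  \<comment> \<open>Inverting q and a while exchanging \<open>?n\<close> and \<open>?m\<close> fixes
    \<open>?U\<close> and \<open>?V\<close> up to the order of summands.\<close>
  have m: "nu (inverse q) (inverse a) ?U ?V = ?m"
    using nu_eq[of "inverse q" "inverse a" ?m ?n] assms by (simp add: add.commute power_inverse)
  show ?thesis
    using nu_cong_mod[OF u v, of q a] nu_cong_mod[OF u v, of "inverse q" "inverse a"] unfolding n m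
    by (cases s) (simp_all add: subst_nu subst_gen subst_mult relation_ideal_zero del: Ay_to_chevalley.simps(1))
qed

text \<open>Modulo the Chevalley relations \<open>?N\<close> and \<open>?M\<close> equal
  \<open>?n\<close> and \<open>?m\<close>, hence satisfy those relations too. By
  \<open>nu_q_commute\<close> and \<open>nu_q_commutator\<close>, nonzero multiples of the required
  relations lie in the ideal, and the scalars can be cancelled.\<close>

lemma Ay_to_chevalley_relations:
  assumes "q \<noteq> 0" and "q ^ 4 \<noteq> 1" and "a \<noteq> 0" and "(l, r) \<in> Ay_relations q a"
  shows "subst (Ay_to_chevalley q a) l - subst (Ay_to_chevalley q a) r \<in> relation_ideal (chevalley_relations q)"
proof -
  note C = chevalley_relation_ideal[of q]
  let ?A = "Ay_to_chevalley q a Ay_A" and ?y = "gen Ch_y :: ('a, chevalley_gen) free_algebra"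
  let ?n = "gen Ch_nux :: ('a, chevalley_gen) free_algebra" and ?m = "gen Ch_nuz :: ('a, chevalley_gen) free_algebra"
  let ?N = "nu q a (?A * ?y) (?y * ?A)" and ?M = "nu (inverse q) (inverse a) (?A * ?y) (?y * ?A)"
  note q = q_diff_nonzero[OF assms(1,2)]
  have N: "?N - ?n \<in> relation_ideal (chevalley_relations q)"
    using chevalley_Ay_chevalley[OF assms(1-3), of Ch_nux] by (simp add: subst_nu subst_simps)
  have M: "?M - ?m \<in> relation_ideal (chevalley_relations q)"
    using chevalley_Ay_chevalley[OF assms(1-3), of Ch_nuz] by (simp add: subst_nu subst_simps)
  have "?y * ?N - (inverse q ^ 2) \<bullet>\<^sub>F (?N * ?y) = ?y * (?N - ?n) - (inverse q ^ 2) \<bullet>\<^sub>F ((?N - ?n) * ?y)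
      + (?y * ?n - (inverse q ^ 2) \<bullet>\<^sub>F (?n * ?y))"
    by (simp add: scal_diff_right right_diff_distrib left_diff_distrib)
  also have "\<dots> \<in> relation_ideal (chevalley_relations q)"
    using N chevalley_commute(1)[OF assms(1)] by (simp only: relation_ideal_intros)
  finally have linear: "Ay_linear_rel q a ?A ?y \<in> relation_ideal (chevalley_relations q)"
    unfolding nu_q_commute[OF assms(1-3)]
    by (rule relation_ideal_scal_cancel) (use assms(1,3) q in simp)
  have "(1 / (q - inverse q)) \<bullet>\<^sub>F (q \<bullet>\<^sub>F (?M * ?N) - inverse q \<bullet>\<^sub>F (?N * ?M)) - (1 - ?y ^ 2)
      \<in> relation_ideal (chevalley_relations q)"
    by (rule q_commutator_mod[OF mult_mod[OF M N] mult_mod[OF N M] C(5)])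
  then have quadratic: "Ay_quadratic_rel q a ?A ?y \<in> relation_ideal (chevalley_relations q)"
    unfolding nu_q_commutator[OF assms(1-3)]
    by (rule relation_ideal_scal_cancel) (use q in simp)
  show ?thesis
    using assms(4) C(1,2) linear quadratic unfolding Ay_relations_def Let_def Ay_linear_rel_def Ay_quadratic_rel_def
    by (auto simp: subst_simps simp del: Ay_to_chevalley.simps(1))
qed

text \<open>The same two identities read the other way: the Chevalley expressions are multiples of
  ideal elements.\<close>

lemma chevalley_to_Ay_relations:
  assumes "q \<noteq> 0" and "q ^ 4 \<noteq> 1" and "a \<noteq> 0" and "(l, r) \<in> chevalley_relations q"
  shows "subst (chevalley_to_Ay q a) l - subst (chevalley_to_Ay q a) r \<in> relation_ideal (Ay_relations q a)"
proof -
  note P = Ay_relation_ideal[of q a]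
  let ?u = "gen Ay_A * gen Ay_y :: ('a, Ay_gen) free_algebra" and ?v = "gen Ay_y * gen Ay_A :: ('a, Ay_gen) free_algebra"
  let ?N = "nu q a ?u ?v" and ?M = "nu (inverse q) (inverse a) ?u ?v"
  have N: "gen Ay_y * ?N * gen Ay_yinv - (inverse q ^ 2) \<bullet>\<^sub>F ?N \<in> relation_ideal (Ay_relations q a)"
    by (rule conj_mod[OF P(1,2)])
      (simp only: nu_q_commute[OF assms(1-3)] relation_ideal_scal[OF P(3)])
  have "inverse q \<noteq> 0" "inverse q ^ 4 \<noteq> 1" "inverse a \<noteq> 0"
    using assms by (simp_all add: power_inverse)
  note nu_q_commute[OF this, of "gen Ay_y" "gen Ay_A", unfolded Ay_linear_rel_inverse inverse_inverse_eq]
  then have M: "gen Ay_y * ?M * gen Ay_yinv - (q ^ 2) \<bullet>\<^sub>F ?M \<in> relation_ideal (Ay_relations q a)"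
    by (intro conj_mod[OF P(1,2)]) (simp only: relation_ideal_scal[OF P(3)])
  have "(1 / (q - inverse q)) \<bullet>\<^sub>F (q \<bullet>\<^sub>F (?M * ?N) - inverse q \<bullet>\<^sub>F (?N * ?M)) - (1 - gen Ay_y ^ 2)
      \<in> relation_ideal (Ay_relations q a)"
    unfolding nu_q_commutator[OF assms(1-3)] by (rule relation_ideal_scal[OF P(4)])
  with N M P(1,2) show ?thesis
    using assms(4) unfolding chevalley_relations_def Let_def
    by (auto simp: subst_simps)
qed

section \<open>The Chevalley generators versus the equitable ones\<close>

lemma chevalley_equitable_chevalley:
  assumes "q \<noteq> 0"
  shows "subst (equitable_to_chevalley q) (chevalley_to_equitable q s) - gen s \<in> relation_ideal (chevalley_relations q)"
proof -
  note C = chevalley_relation_ideal[of q]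
  let ?n = "gen Ch_nux :: ('a, chevalley_gen) free_algebra" and ?m = "gen Ch_nuz :: ('a, chevalley_gen) free_algebra"
  have "subst (equitable_to_chevalley q) (chevalley_to_equitable q Ch_nux) - ?n
      = - (inverse q \<bullet>\<^sub>F ((1 - q \<bullet>\<^sub>F ?n) * (gen Ch_yinv * gen Ch_y - 1)))"
    and "subst (equitable_to_chevalley q) (chevalley_to_equitable q Ch_nuz) - ?m
      = - (q \<bullet>\<^sub>F ((1 - inverse q \<bullet>\<^sub>F ?m) * (gen Ch_yinv * gen Ch_y - 1)))"
    using assms by (simp_all add: subst_simps mult_inverse_cancel scal_simps algebra_simps)
  then show ?thesis
    using C(2) by (cases s) (simp_all add: subst_gen relation_ideal_intros del: chevalley_to_equitable.simps(1,4))
qed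

lemma equitable_chevalley_equitable:
  assumes "q \<noteq> 0"
  shows "subst (chevalley_to_equitable q) (equitable_to_chevalley q s) - gen s \<in> relation_ideal (equitable_relations q)"
proof -
  have "subst (chevalley_to_equitable q) (equitable_to_chevalley q Eq_x) - gen Eq_x
      = gen Eq_x * (gen Eq_y * gen Eq_yinv - 1)"
    and "subst (chevalley_to_equitable q) (equitable_to_chevalley q Eq_z) - gen Eq_z
      = gen Eq_z * (gen Eq_y * gen Eq_yinv - 1)"
    using assms by (simp_all add: subst_simps mult_inverse_cancel scal_simps algebra_simps)
  then show ?thesis
    using equitable_relation_ideal(1)[of q]
    by (cases s) (simp_all add: subst_gen relation_ideal_intros del: equitable_to_chevalley.simps(1,4))
qed

lemma equitable_to_chevalley_relations:
  assumes "q \<noteq> 0" and "q ^ 4 \<noteq> 1" and "(l, r) \<in> equitable_relations q"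
  shows "subst (equitable_to_chevalley q) l - subst (equitable_to_chevalley q) r
    \<in> relation_ideal (chevalley_relations q)"
proof -
  note C = chevalley_relation_ideal[of q] and D = chevalley_commute[OF assms(1)]
  define c where "c = 1 / (q - inverse q)"
  have c: "c * (q - inverse q) = 1"
    using q_diff_nonzero[OF assms(1,2)] by (simp add: c_def)
  let ?I = "relation_ideal (chevalley_relations q)"
  let ?y = "gen Ch_y :: ('a, chevalley_gen) free_algebra" and ?yi = "gen Ch_yinv :: ('a, chevalley_gen) free_algebra"
  let ?n = "gen Ch_nux :: ('a, chevalley_gen) free_algebra" and ?m = "gen Ch_nuz :: ('a, chevalley_gen) free_algebra"
  let ?X = "equitable_to_chevalley q Eq_x" and ?Z = "equitable_to_chevalley q Eq_z"
  have "?X * ?y - (1 - inverse q \<bullet>\<^sub>F ?m) = (1 - inverse q \<bullet>\<^sub>F ?m) * (?yi * ?y - 1)"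
    by (simp add: algebra_simps)
  then have Xy: "?X * ?y - (1 - inverse q \<bullet>\<^sub>F ?m) \<in> ?I"
    using C(2) by (simp only: relation_ideal_mult_left)
  have "?Z * ?y - (1 - q \<bullet>\<^sub>F ?n) = (1 - q \<bullet>\<^sub>F ?n) * (?yi * ?y - 1)"
    by (simp add: algebra_simps)
  then have Zy: "?Z * ?y - (1 - q \<bullet>\<^sub>F ?n) \<in> ?I"
    using C(2) by (simp only: relation_ideal_mult_left)
  have "?y * ?X - (1 - q \<bullet>\<^sub>F ?m) = (?y * ?yi - 1) - inverse q \<bullet>\<^sub>F (?y * ?m * ?yi - (q ^ 2) \<bullet>\<^sub>F ?m)"
    using assms(1) by (simp add: mult_inverse_cancel scal_simps algebra_simps power2_eq_square)
  then have yX: "?y * ?X - (1 - q \<bullet>\<^sub>F ?m) \<in> ?I"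
    using C by (simp only: relation_ideal_intros)
  have "?y * ?Z - (1 - inverse q \<bullet>\<^sub>F ?n) = (?y * ?yi - 1) - q \<bullet>\<^sub>F (?y * ?n * ?yi - (inverse q ^ 2) \<bullet>\<^sub>F ?n)"
    using assms(1) by (simp add: mult_inverse_cancel scal_simps algebra_simps power2_eq_square)
  then have yZ: "?y * ?Z - (1 - inverse q \<bullet>\<^sub>F ?n) \<in> ?I"
    using C by (simp only: relation_ideal_intros)
  \<comment> \<open>This settles the relations for x, y and for y, z: the linear terms of the
    residues cancel in the q-commutator.\<close>
  have lin: "c \<bullet>\<^sub>F (q \<bullet>\<^sub>F (1 - inverse q \<bullet>\<^sub>F p) - inverse q \<bullet>\<^sub>F (1 - q \<bullet>\<^sub>F p)) - 1 \<in> ?I" for p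
  proof -
    have "q \<bullet>\<^sub>F (1 - inverse q \<bullet>\<^sub>F p) - inverse q \<bullet>\<^sub>F (1 - q \<bullet>\<^sub>F p) = (q - inverse q) \<bullet>\<^sub>F 1"
      using assms(1) by (simp add: scal_simps)
    then show ?thesis by (simp add: scal_scal c scal_one relation_ideal_zero)
  qed
  have xy: "c \<bullet>\<^sub>F (q \<bullet>\<^sub>F (?X * ?y) - inverse q \<bullet>\<^sub>F (?y * ?X)) - 1 \<in> ?I"
    by (rule q_commutator_mod[OF Xy yX lin])
  have yz: "c \<bullet>\<^sub>F (q \<bullet>\<^sub>F (?y * ?Z) - inverse q \<bullet>\<^sub>F (?Z * ?y)) - 1 \<in> ?I"
    by (rule q_commutator_mod[OF yZ Zy lin])
  \<comment> \<open>The inner y^-1 is moved to the right end. Passing \<open>?m\<close> costs q^-2,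
    which turns q^-1 into q^-3; in \<open>?X * ?Z\<close> below, q likewise becomes q^3.\<close>
  have "?Z * ?X - (1 - q \<bullet>\<^sub>F ?n) * (1 - (inverse q ^ 3) \<bullet>\<^sub>F ?m) * ?yi * ?yi
      = - (inverse q \<bullet>\<^sub>F ((1 - q \<bullet>\<^sub>F ?n) * (?yi * ?m - (inverse q ^ 2) \<bullet>\<^sub>F (?m * ?yi)) * ?yi))"
    by (simp add: mult_inverse_cancel scal_simps algebra_simps power2_eq_square power3_eq_cube)
  then have ZX: "?Z * ?X - (1 - q \<bullet>\<^sub>F ?n) * (1 - (inverse q ^ 3) \<bullet>\<^sub>F ?m) * ?yi * ?yi \<in> ?I"
    using D(4) by (simp only: relation_ideal_intros)
  have "?X * ?Z - (1 - inverse q \<bullet>\<^sub>F ?m) * (1 - (q ^ 3) \<bullet>\<^sub>F ?n) * ?yi * ?yi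
      = - (q \<bullet>\<^sub>F ((1 - inverse q \<bullet>\<^sub>F ?m) * (?yi * ?n - (q ^ 2) \<bullet>\<^sub>F (?n * ?yi)) * ?yi))"
    by (simp add: mult_inverse_cancel scal_simps algebra_simps power2_eq_square power3_eq_cube)
  then have XZ: "?X * ?Z - (1 - inverse q \<bullet>\<^sub>F ?m) * (1 - (q ^ 3) \<bullet>\<^sub>F ?n) * ?yi * ?yi \<in> ?I"
    using D(3) by (simp only: relation_ideal_intros)
  let ?K = "q \<bullet>\<^sub>F (?m * ?n) - inverse q \<bullet>\<^sub>F (?n * ?m)"
  \<comment> \<open>The exponents 3 are exactly those for which the terms linear in
    \<open>?n\<close> and \<open>?m\<close> cancel.\<close>
  have "q \<bullet>\<^sub>F ((1 - q \<bullet>\<^sub>F ?n) * (1 - (inverse q ^ 3) \<bullet>\<^sub>F ?m) * ?yi * ?yi)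
       - inverse q \<bullet>\<^sub>F ((1 - inverse q \<bullet>\<^sub>F ?m) * (1 - (q ^ 3) \<bullet>\<^sub>F ?n) * ?yi * ?yi)
      = ((q - inverse q) \<bullet>\<^sub>F 1 - ?K) * ?yi * ?yi"
    using assms(1) by (simp add: mult_inverse_cancel scal_simps algebra_simps power3_eq_cube)
  then have "c \<bullet>\<^sub>F (q \<bullet>\<^sub>F ((1 - q \<bullet>\<^sub>F ?n) * (1 - (inverse q ^ 3) \<bullet>\<^sub>F ?m) * ?yi * ?yi)
       - inverse q \<bullet>\<^sub>F ((1 - inverse q \<bullet>\<^sub>F ?m) * (1 - (q ^ 3) \<bullet>\<^sub>F ?n) * ?yi * ?yi)) - 1
      = (1 - c \<bullet>\<^sub>F ?K) * ?yi * ?yi - 1"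
    by (simp only: mult_scal_left[symmetric] scal_diff_right[of c] scal_scal c scal_one)
  \<comment> \<open>The Chevalley relation turns 1 - c K into y^2, so the claim becomes y^2 y^-2 =
    1, reached by cancelling the inner pair and then the outer one.\<close>
  also have "\<dots> = ?y * (?y * ?yi - 1) * ?yi + (?y * ?yi - 1) - (c \<bullet>\<^sub>F ?K - (1 - ?y ^ 2)) * ?yi * ?yi"
    by (simp add: algebra_simps power2_eq_square)
  also have "\<dots> \<in> ?I"
    using C unfolding c_def by (simp only: relation_ideal_intros)
  finally have zx: "c \<bullet>\<^sub>F (q \<bullet>\<^sub>F (?Z * ?X) - inverse q \<bullet>\<^sub>F (?X * ?Z)) - 1 \<in> ?I"
    by (rule q_commutator_mod[OF ZX XZ])
  show ?thesis
    using assms(3) xy yz zx C(1,2) unfolding equitable_relations_def Let_def c_def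
    by (auto simp: subst_simps simp del: equitable_to_chevalley.simps(1,4))
qed

lemma chevalley_to_equitable_relations:
  assumes "q \<noteq> 0" and "q ^ 4 \<noteq> 1" and "(l, r) \<in> chevalley_relations q"
  shows "subst (chevalley_to_equitable q) l - subst (chevalley_to_equitable q) r
    \<in> relation_ideal (equitable_relations q)"
proof -
  note E = equitable_relation_ideal[of q]
  define c where "c = 1 / (q - inverse q)"
  have c: "(q - inverse q) * c = 1" and c': "c * (q - inverse q) = 1"
    using q_diff_nonzero[OF assms(1,2)] by (simp_all add: c_def)
  let ?I = "relation_ideal (equitable_relations q)"
  let ?x = "gen Eq_x :: ('a, equitable_gen) free_algebra" and ?y = "gen Eq_y :: ('a, equitable_gen) free_algebra"
  let ?z = "gen Eq_z :: ('a, equitable_gen) free_algebra" and ?yi = "gen Eq_yinv :: ('a, equitable_gen) free_algebra"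
  let ?N = "chevalley_to_equitable q Ch_nux" and ?M = "chevalley_to_equitable q Ch_nuz"
  \<comment> \<open>Clears the denominator, so that the equitable relations can be solved for y x
    and y z.\<close>
  have clear: "(q - inverse q) \<bullet>\<^sub>F (c \<bullet>\<^sub>F p - 1) = p - (q - inverse q) \<bullet>\<^sub>F 1" for p :: "('a, equitable_gen) free_algebra"
    by (simp only: scal_diff_right scal_scal c scal_one)
  have "?y * ?x - ((q ^ 2) \<bullet>\<^sub>F (?x * ?y) + (1 - q ^ 2) \<bullet>\<^sub>F 1)
      = - (q \<bullet>\<^sub>F (q - inverse q) \<bullet>\<^sub>F (c \<bullet>\<^sub>F (q \<bullet>\<^sub>F (?x * ?y) - inverse q \<bullet>\<^sub>F (?y * ?x)) - 1))"
    unfolding clear using assms(1) by (simp add: mult_inverse_cancel scal_simps algebra_simps power2_eq_square)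
  then have yx: "?y * ?x - ((q ^ 2) \<bullet>\<^sub>F (?x * ?y) + (1 - q ^ 2) \<bullet>\<^sub>F 1) \<in> ?I"
    using E(3) unfolding c_def by (simp only: relation_ideal_intros)
  have "?y * ?z - ((inverse q ^ 2) \<bullet>\<^sub>F (?z * ?y) + (1 - inverse q ^ 2) \<bullet>\<^sub>F 1)
      = inverse q \<bullet>\<^sub>F (q - inverse q) \<bullet>\<^sub>F (c \<bullet>\<^sub>F (q \<bullet>\<^sub>F (?y * ?z) - inverse q \<bullet>\<^sub>F (?z * ?y)) - 1)"
    unfolding clear using assms(1) by (simp add: mult_inverse_cancel scal_simps algebra_simps power2_eq_square)
  then have yz: "?y * ?z - ((inverse q ^ 2) \<bullet>\<^sub>F (?z * ?y) + (1 - inverse q ^ 2) \<bullet>\<^sub>F 1) \<in> ?I"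
    using E(4) unfolding c_def by (simp only: relation_ideal_intros)
  have "?y * ?N * ?yi - (inverse q ^ 2) \<bullet>\<^sub>F ?N = inverse q \<bullet>\<^sub>F ((?y * ?yi - 1) - ?y * ?z * (?y * ?yi - 1))
      - inverse q \<bullet>\<^sub>F (?y * ?z - ((inverse q ^ 2) \<bullet>\<^sub>F (?z * ?y) + (1 - inverse q ^ 2) \<bullet>\<^sub>F 1))"
    by (simp add: mult_inverse_cancel scal_simps algebra_simps)
  then have N: "?y * ?N * ?yi - (inverse q ^ 2) \<bullet>\<^sub>F ?N \<in> ?I"
    using yz E(1) by (simp only: relation_ideal_intros)
  have "?y * ?M * ?yi - (q ^ 2) \<bullet>\<^sub>F ?M = q \<bullet>\<^sub>F ((?y * ?yi - 1) - ?y * ?x * (?y * ?yi - 1))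
      - q \<bullet>\<^sub>F (?y * ?x - ((q ^ 2) \<bullet>\<^sub>F (?x * ?y) + (1 - q ^ 2) \<bullet>\<^sub>F 1))"
    by (simp add: mult_inverse_cancel scal_simps algebra_simps)
  then have M: "?y * ?M * ?yi - (q ^ 2) \<bullet>\<^sub>F ?M \<in> ?I"
    using yx E(1) by (simp only: relation_ideal_intros)
  \<comment> \<open>\<open>?R\<close> is the ideal element produced by moving the inner y to the
    right in x y z y and z y x y. The terms so created cancel those in x y and z y, leaving only the
    z, x commutator times y^2.\<close>
  let ?R = "q \<bullet>\<^sub>F (?x * (?y * ?z - ((inverse q ^ 2) \<bullet>\<^sub>F (?z * ?y) + (1 - inverse q ^ 2) \<bullet>\<^sub>F 1)) * ?y)
        - inverse q \<bullet>\<^sub>F (?z * (?y * ?x - ((q ^ 2) \<bullet>\<^sub>F (?x * ?y) + (1 - q ^ 2) \<bullet>\<^sub>F 1)) * ?y)"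
  let ?K = "q \<bullet>\<^sub>F (?z * ?x) - inverse q \<bullet>\<^sub>F (?x * ?z)"
  have "q \<bullet>\<^sub>F (?M * ?N) - inverse q \<bullet>\<^sub>F (?N * ?M) = (q - inverse q) \<bullet>\<^sub>F 1 + ?R - ?K * ?y ^ 2"
    using assms(1) by (simp add: mult_inverse_cancel scal_simps algebra_simps power2_eq_square)
  then have "c \<bullet>\<^sub>F (q \<bullet>\<^sub>F (?M * ?N) - inverse q \<bullet>\<^sub>F (?N * ?M)) - (1 - ?y ^ 2)
      = c \<bullet>\<^sub>F ?R - (c \<bullet>\<^sub>F ?K - 1) * ?y ^ 2"
    by (simp only: scal_diff_right[of c] scal_add_right[of c] scal_scal c' scal_one mult_scal_left[symmetric])
      (simp add: left_diff_distrib)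
  then have K: "c \<bullet>\<^sub>F (q \<bullet>\<^sub>F (?M * ?N) - inverse q \<bullet>\<^sub>F (?N * ?M)) - (1 - ?y ^ 2) \<in> ?I"
    using yz yx E(5) unfolding c_def by (simp only: relation_ideal_intros)
  show ?thesis
    using assms(3) N M K E(1,2) unfolding chevalley_relations_def Let_def c_def
    by (auto simp: subst_simps simp del: chevalley_to_equitable.simps(1,4))
qed

text \<open>The presentation of \<open>Uq_sl2 q\<close> is the composite of \<psi>, from A, y to the
  Chevalley generators, with \<chi>, from there to the equitable ones. The explicit formulas concern
  \<psi> alone.\<close>

theorem theorem9p1:
  fixes q a :: "'f::field"
  assumes "q \<noteq> 0" and "q ^ 4 \<noteq> 1" and "a \<noteq> 0" and "a ^ 2 \<noteq> 1"
  shows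
    "has_presentation (Uq_sl2 q)
       (\<lambda>s. case s of Ay_A \<Rightarrow> Uq_A q a | Ay_y \<Rightarrow> Uq_y q | Ay_yinv \<Rightarrow> Uq_yinv q)
       (Ay_relations q a) \<and>
     (let P = presented_algebra (Ay_relations q a);
          C = presented_algebra (chevalley_relations q);
          clsP = presented_class (Ay_relations q a);
          clsC = presented_class (chevalley_relations q);
          A = gen Ay_A; y = gen Ay_y; yi = gen Ay_yinv;
          nux = gen Ch_nux; y' = gen Ch_y; yi' = gen Ch_yinv; nuz = gen Ch_nuz
      in \<exists>\<psi>\<in>alg_iso P C.
        \<psi> (clsP A) = clsC (a \<bullet>\<^sub>F ((1 - q \<bullet>\<^sub>F nux) * yi')
                         + inverse a \<bullet>\<^sub>F ((1 - inverse q \<bullet>\<^sub>F nuz) * yi')) \<and>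
        \<psi> (clsP y) = clsC y' \<and>
        \<psi> (clsP yi) = clsC yi' \<and>
        inv_into (carrier P) \<psi> (clsC nux) =
          clsP ((inverse a * ((a + inverse a) / (q + inverse q))) \<bullet>\<^sub>F 1
                - inverse a \<bullet>\<^sub>F (1 / (q ^ 2 - inverse q ^ 2)) \<bullet>\<^sub>F
                    (q \<bullet>\<^sub>F (A * y) - inverse q \<bullet>\<^sub>F (y * A))) \<and>
        inv_into (carrier P) \<psi> (clsC y') = clsP y \<and>
        inv_into (carrier P) \<psi> (clsC yi') = clsP yi \<and>
        inv_into (carrier P) \<psi> (clsC nuz) =
          clsP ((a * ((a + inverse a) / (q + inverse q))) \<bullet>\<^sub>F 1
                - a \<bullet>\<^sub>F (1 / (q ^ 2 - inverse q ^ 2)) \<bullet>\<^sub>F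
                    (q \<bullet>\<^sub>F (y * A) - inverse q \<bullet>\<^sub>F (A * y))))"
proof -
  obtain \<psi> where \<psi>: "\<psi> \<in> alg_iso (presented_algebra (Ay_relations q a)) (presented_algebra (chevalley_relations q))"
      "\<And>p. \<psi> (presented_class (Ay_relations q a) p)
        = presented_class (chevalley_relations q) (subst (Ay_to_chevalley q a) p)"
      "\<And>p. inv_into (carrier (presented_algebra (Ay_relations q a))) \<psi> (presented_class (chevalley_relations q) p)
        = presented_class (Ay_relations q a) (subst (chevalley_to_Ay q a) p)"
    by (rule presented_algebra_iso[OF Ay_to_chevalley_relations[OF assms(1-3)]
          chevalley_to_Ay_relations[OF assms(1-3)] Ay_chevalley_Ay[OF assms(1-3)]
          chevalley_Ay_chevalley[OF assms(1-3)]]) blast+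
  obtain \<chi> where \<chi>: "\<chi> \<in> alg_iso (presented_algebra (chevalley_relations q)) (Uq_sl2 q)"
      "\<And>p. \<chi> (presented_class (chevalley_relations q) p)
        = presented_class (equitable_relations q) (subst (chevalley_to_equitable q) p)"
    unfolding Uq_sl2_def
    by (rule presented_algebra_iso[OF chevalley_to_equitable_relations[OF assms(1,2)]
          equitable_to_chevalley_relations[OF assms(1,2)] chevalley_equitable_chevalley[OF assms(1)]
          equitable_chevalley_equitable[OF assms(1)]]) blast+
  let ?A = "subst (chevalley_to_equitable q) (Ay_to_chevalley q a Ay_A)"
  \<comment> \<open>Substituting for \<open>nux\<close> and \<open>nuz\<close> turns the image of A
    into a z y y^-1 + a^-1 x y y^-1.\<close>
  have "?A - (inverse a \<bullet>\<^sub>F gen Eq_x + a \<bullet>\<^sub>F gen Eq_z)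
      = a \<bullet>\<^sub>F (gen Eq_z * (gen Eq_y * gen Eq_yinv - 1)) + inverse a \<bullet>\<^sub>F (gen Eq_x * (gen Eq_y * gen Eq_yinv - 1))"
    using assms(1) by (simp add: subst_simps mult_inverse_cancel scal_simps algebra_simps)
  then have "presented_class (equitable_relations q) ?A = Uq_A q a"
    using equitable_relation_ideal(1)[of q] unfolding Uq_A_def presented_class_eq_iff
    by (simp only: relation_ideal_intros)
  then have "(\<chi> \<circ> \<psi>) (presented_class (Ay_relations q a) (gen s))
      = (case s of Ay_A \<Rightarrow> Uq_A q a | Ay_y \<Rightarrow> Uq_y q | Ay_yinv \<Rightarrow> Uq_yinv q)" for s
    by (cases s) (simp_all add: \<psi> \<chi> subst_gen Uq_y_def Uq_yinv_def del: Ay_to_chevalley.simps(1))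
  then have "has_presentation (Uq_sl2 q)
       (\<lambda>s. case s of Ay_A \<Rightarrow> Uq_A q a | Ay_y \<Rightarrow> Uq_y q | Ay_yinv \<Rightarrow> Uq_yinv q) (Ay_relations q a)"
    unfolding has_presentation_def using alg_iso_comp[OF \<psi>(1) \<chi>(1)] by blast
  \<comment> \<open>\<open>nu_inverse\<close> is applied before \<open>nu_def\<close>, so that the
    image of \<open>nuz\<close> takes its stated form instead of one with inverted
    parameters.\<close>
  then show ?thesis
    unfolding Let_def
    by (intro conjI bexI[OF _ \<psi>(1)]) (simp_all only: \<psi> subst_gen Ay_to_chevalley.simps
        chevalley_to_Ay.simps nu_inverse, simp_all only: nu_def)
qed

end
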